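(* Let $\varphi=(1+\sqrt5)/2$. For every $s\in[1,\varphi]$ there exists a Minkowski centered $C\in\mathcal K^2$ with $s(C)=s$ such that $$C\cap(-C)\subset^{opt}\mathrm{conv}(C\cup(-C)).$$
   Context: $\mathcal K^n$ denotes the set of convex bodies in $\mathbb R^n$, i.e. full-dimensional compact convex sets. $\mathrm{conv}(X)$ is the convex hull of $X$. For $C\subset\mathbb R^n$ and $\rho\in\mathbb R$: $\rho C=\{\rho x:x\in C\}$ and $-C=(-1)C$. Optimal containment: for $K,C\in\mathcal K^n$, $K\subset^{opt}C$ means that $K\subset C$ and $K\not\subset t+\rho C$ for any $0\le\rho<1$ and $t\in\mathbb R^n$. Minkowski asymmetry: $s(C):=\inf\{\rho>0: C-c\subset\rho(c-C) \text{ for some } c\in\mathbb R^n\}$. A Minkowski center of $C$ is any $c\in\mathbb R^n$ with $C-c\subset s(C)(c-C)$. $C$ is Minkowski centered if $0$ is a Minkowski center of $C$, i.e. $C\subset -s(C)\,C$. *)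

theory Defs
  imports "HOL-Analysis.Analysis"
begin

definition convex_body :: "'a::euclidean_space set \<Rightarrow> bool" where
  "convex_body C \<longleftrightarrow> convex C \<and> compact C \<and> aff_dim C = int DIM('a)"

(* The relation is meant for convex bodies; the formula makes sense for arbitrary sets. *)
definition optimally_contained :: "'a::euclidean_space set \<Rightarrow> 'a set \<Rightarrow> bool"
    (infix "\<subseteq>opt" 50) where
  "K \<subseteq>opt C \<longleftrightarrow> K \<subseteq> C \<and>
     (\<forall>\<rho> t. 0 \<le> \<rho> \<and> \<rho> < 1 \<longrightarrow> \<not> K \<subseteq> (\<lambda>x. t + \<rho> *\<^sub>R x) ` C)"

(* For a convex body the set below is nonempty (and bounded below by 0), so the real-valued
   Inf is the true infimum. *)
definition minkowski_asymmetry :: "'a::euclidean_space set \<Rightarrow> real" where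
  "minkowski_asymmetry C =
     Inf {\<rho>. \<rho> > 0 \<and> (\<exists>c. (\<lambda>x. x - c) ` C \<subseteq> (\<lambda>x. \<rho> *\<^sub>R (c - x)) ` C)}"

definition minkowski_center :: "'a::euclidean_space \<Rightarrow> 'a set \<Rightarrow> bool" where
  "minkowski_center c C \<longleftrightarrow>
     (\<lambda>x. x - c) ` C \<subseteq> (\<lambda>x. minkowski_asymmetry C *\<^sub>R (c - x)) ` C"

definition minkowski_centered :: "'a::euclidean_space set \<Rightarrow> bool" where
  "minkowski_centered C \<longleftrightarrow> minkowski_center 0 C"

end

(* The witness is a pentagonal "house": a box |x| <= 1, y >= -1 with a symmetric roof that has its
   apex at (0, s) and slope s^2 - 1.  The slope is chosen so that -C/s touches the floor and both
   halves of the roof; the three normals are positively dependent, which forces s(C) = s.  The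
   eaves have height 1 + s - s^2, which is nonnegative exactly for s <= (1 + sqrt 5)/2; then
   (1, 0) and (-1, 0) lie in C and in -C, and they touch the strip |x| <= 1 that contains both. *)
theory Submission
  imports Defs
begin

definition house :: "real \<Rightarrow> (real ^ 2) set" where
  "house s = {x. \<bar>x $ 1\<bar> \<le> 1 \<and> - 1 \<le> x $ 2 \<and> x $ 2 + (s\<^sup>2 - 1) * \<bar>x $ 1\<bar> \<le> s}"

lemma convex_house:
  assumes "1 \<le> s"
  shows "convex (house s)"
proof -
  have "0 \<le> s\<^sup>2 - 1"
    using assms by simp
  \<comment> \<open>With a nonnegative slope the roof bound splits into two linear inequalities, one
    for each sign of \<open>x $ 1\<close>.\<close>
  then have roof: "(s\<^sup>2 - 1) * \<bar>z\<bar> = \<bar>(s\<^sup>2 - 1) * z\<bar>" for z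
    by (simp add: abs_mult)
  have "house s = {x. \<bar>vector [1, 0] \<bullet> x\<bar> \<le> 1} \<inter> {x. vector [0, 1] \<bullet> x \<ge> - 1}
      \<inter> {x. vector [s\<^sup>2 - 1, 1] \<bullet> x \<le> s} \<inter> {x. vector [- (s\<^sup>2 - 1), 1] \<bullet> x \<le> s}"
    unfolding house_def roof by (auto simp: inner_vec_def sum_2 abs_le_iff algebra_simps)
  then show ?thesis
    by (simp only: convex_Int convex_halfspace_abs_le convex_halfspace_le convex_halfspace_ge)
qed

lemma compact_house:
  assumes "1 \<le> s"
  shows "compact (house s)"
proof -
  have "closed (house s)"
    unfolding house_def by (intro closed_Collect_conj closed_Collect_le continuous_intros)
  moreover have "house s \<subseteq> cbox (vector [-1, -1]) (vector [1, s])"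
  proof
    fix x
    assume "x \<in> house s"
    moreover have "0 \<le> (s\<^sup>2 - 1) * \<bar>x $ 1\<bar>"
      using assms by simp
    ultimately show "x \<in> cbox (vector [-1, -1]) (vector [1, s])"
      by (auto simp: house_def mem_box_cart forall_2)
  qed
  ultimately show ?thesis
    using bounded_subset[OF bounded_cbox] compact_eq_bounded_closed by blast
qed

lemma aff_dim_house:
  assumes "1 \<le> s"
  shows "aff_dim (house s) = 2"
proof -
  let ?U = "{x :: real ^ 2. \<bar>x $ 1\<bar> < 1 \<and> - 1 < x $ 2 \<and> x $ 2 + (s\<^sup>2 - 1) * \<bar>x $ 1\<bar> < s}"
  have "open ?U"
    by (intro open_Collect_conj open_Collect_less continuous_intros)
  moreover have "0 \<in> ?U"
    using assms by auto
  moreover have "?U \<subseteq> house s"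
    by (auto simp: house_def)
  ultimately have "0 \<in> interior (house s)"
    by (rule interiorI)
  then have "interior (house s) \<noteq> {}"
    by blast
  from aff_dim_nonempty_interior[OF this] show ?thesis
    by simp
qed

text \<open>This one inclusion gives both the upper bound for the asymmetry and the fact that 0 is a
  center.\<close>

lemma house_subset_scaled_reflection:
  assumes "1 \<le> s"
  shows "house s \<subseteq> (\<lambda>x. s *\<^sub>R (0 - x)) ` house s"
proof
  fix x
  assume x: "x \<in> house s"
  have s: "0 < s" "0 \<le> s\<^sup>2 - 1"
    using assms by auto
  have "(s\<^sup>2 - 1) * \<bar>x $ 1\<bar> \<le> s\<^sup>2 - 1" "0 \<le> (s\<^sup>2 - 1) * \<bar>x $ 1\<bar>"
    using x s mult_left_mono[of "\<bar>x $ 1\<bar>" 1 "s\<^sup>2 - 1"] by (auto simp: house_def)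
  \<comment> \<open>These are the floor, roof and wall conditions for
    \<open>- (1 / s) *\<^sub>R x\<close>, cleared of denominators. The roof condition adds
    \<open>- x $ 2 \<le> 1\<close> to the bound \<open>s\<^sup>2 - 1\<close> above, which is where
    the slope fits exactly.\<close>
  with x have "x $ 2 \<le> s" "- x $ 2 + (s\<^sup>2 - 1) * \<bar>x $ 1\<bar> \<le> s * s" "\<bar>x $ 1\<bar> \<le> s"
    using assms by (auto simp: house_def power2_eq_square)
  moreover have "- (x $ 2 / s) + (s\<^sup>2 - 1) * (\<bar>x $ 1\<bar> / s)
      = (- x $ 2 + (s\<^sup>2 - 1) * \<bar>x $ 1\<bar>) / s"
    by (simp add: add_divide_distrib diff_divide_distrib)
  ultimately have "- (1 / s) *\<^sub>R x \<in> house s"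
    using s by (simp add: house_def abs_mult divide_le_eq)
  moreover have "x = s *\<^sub>R (0 - (- (1 / s) *\<^sub>R x))"
    using s by simp
  ultimately show "x \<in> (\<lambda>x. s *\<^sub>R (0 - x)) ` house s"
    by blast
qed

text \<open>The apex and the two bottom corners are reflected into the house; testing the images
  against the floor and the two roof halves gives three inequalities whose combination eliminates
  the unknown \<open>c\<close>.\<close>

lemma house_asymmetry_lower_bound:
  assumes s: "1 \<le> s" "0 \<le> 1 + s - s\<^sup>2"
    and \<rho>: "0 < \<rho>" and sub: "(\<lambda>x. x - c) ` house s \<subseteq> (\<lambda>x. \<rho> *\<^sub>R (c - x)) ` house s"
  shows "s \<le> \<rho>"
proof -
  have reflect: "\<exists>y \<in> house s. x + \<rho> *\<^sub>R y = (1 + \<rho>) *\<^sub>R c" if x: "x \<in> house s" for x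
  proof -
    obtain y where "y \<in> house s" "x - c = \<rho> *\<^sub>R (c - y)"
      using sub x by blast
    then show ?thesis
      by (intro bexI[of _ y]) (auto simp: algebra_simps)
  qed
  \<comment> \<open>The bottom corners lie below the roof because
    \<open>s\<^sup>2 - 2 \<le> s\<close>, a consequence of the eaves condition.\<close>
  have "vector [0, s] \<in> house s" "vector [1, -1] \<in> house s" "vector [-1, -1] \<in> house s"
    using s by (auto simp: house_def)
  then obtain u v w where uvw: "u \<in> house s" "v \<in> house s" "w \<in> house s"
    and eqs: "vector [0, s] + \<rho> *\<^sub>R u = (1 + \<rho>) *\<^sub>R c"
      "vector [1, -1] + \<rho> *\<^sub>R v = (1 + \<rho>) *\<^sub>R c"
      "vector [-1, -1] + \<rho> *\<^sub>R w = (1 + \<rho>) *\<^sub>R c"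
    using reflect by metis
  define k where "k = s\<^sup>2 - 1"
  have k: "0 \<le> k"
    using s by (simp add: k_def)
  have u: "(1 + \<rho>) * c $ 2 = s + \<rho> * u $ 2"
    using arg_cong[OF eqs(1), of "\<lambda>x. x $ 2"] by simp
  have v: "(1 + \<rho>) * c $ 1 = 1 + \<rho> * v $ 1" "(1 + \<rho>) * c $ 2 = - 1 + \<rho> * v $ 2"
    using arg_cong[OF eqs(2), of "\<lambda>x. x $ 1"] arg_cong[OF eqs(2), of "\<lambda>x. x $ 2"] by simp_all
  have w: "(1 + \<rho>) * c $ 1 = - 1 + \<rho> * w $ 1" "(1 + \<rho>) * c $ 2 = - 1 + \<rho> * w $ 2"
    using arg_cong[OF eqs(3), of "\<lambda>x. x $ 1"] arg_cong[OF eqs(3), of "\<lambda>x. x $ 2"] by simp_all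
  \<comment> \<open>Each bottom corner is tested against the roof half on the opposite side, so only
    one sign of the absolute value is kept.\<close>
  have "k * - (v $ 1) \<le> k * \<bar>v $ 1\<bar>" "k * w $ 1 \<le> k * \<bar>w $ 1\<bar>"
    by (rule mult_left_mono; use k in simp)+
  then have roof: "v $ 2 - k * v $ 1 \<le> s" "w $ 2 + k * w $ 1 \<le> s" and floor: "- 1 \<le> u $ 2"
    using uvw by (auto simp: house_def k_def)
  define d where "d = (1 + \<rho>) * c $ 1"
  define e where "e = (1 + \<rho>) * c $ 2"
  have "e - k * d = \<rho> * (v $ 2 - k * v $ 1) - 1 - k"
    unfolding d_def e_def v by (simp add: algebra_simps)
  also have "\<dots> \<le> \<rho> * s - 1 - k"
    using mult_left_mono[OF roof(1), of \<rho>] \<rho> by simp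
  finally have left: "e - k * d \<le> \<rho> * s - s\<^sup>2"
    by (simp add: k_def)
  have "e + k * d = \<rho> * (w $ 2 + k * w $ 1) - 1 - k"
    unfolding d_def e_def w by (simp add: algebra_simps)
  also have "\<dots> \<le> \<rho> * s - 1 - k"
    using mult_left_mono[OF roof(2), of \<rho>] \<rho> by simp
  finally have right: "e + k * d \<le> \<rho> * s - s\<^sup>2"
    by (simp add: k_def)
  have "s - \<rho> \<le> e"
    using u mult_left_mono[OF floor, of \<rho>] \<rho> by (simp add: e_def)
  \<comment> \<open>Adding \<open>left\<close> and \<open>right\<close> cancels the horizontal term
    \<open>k * d\<close> and leaves \<open>e \<le> \<rho> * s - s\<^sup>2\<close>, to be compared
    with \<open>s - \<rho> \<le> e\<close>.\<close>
  with left right have "s * (1 + s) \<le> \<rho> * (1 + s)"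
    by (simp add: algebra_simps power2_eq_square)
  then show ?thesis
    using s by simp
qed

lemma minkowski_asymmetry_house:
  assumes "1 \<le> s" "0 \<le> 1 + s - s\<^sup>2"
  shows "minkowski_asymmetry (house s) = s"
  unfolding minkowski_asymmetry_def
proof (rule cInf_eq_minimum)
  show "s \<in> {\<rho>. \<rho> > 0 \<and> (\<exists>c. (\<lambda>x. x - c) ` house s \<subseteq> (\<lambda>x. \<rho> *\<^sub>R (c - x)) ` house s)}"
    using house_subset_scaled_reflection[OF assms(1)] assms(1) by (auto intro!: exI[of _ 0])
qed (use house_asymmetry_lower_bound assms in blast)

text \<open>A width argument: in direction \<open>a\<close> the points \<open>p\<close> and
  \<open>- p\<close> are 2 apart, while a translate of \<open>\<rho>\<close> times \<open>L\<close>
  has width at most \<open>2 * \<rho> < 2\<close>.\<close>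

lemma optimally_contained_between_parallel_hyperplanes:
  fixes a :: "'a::euclidean_space"
  assumes "K \<subseteq> L" "p \<in> K" "- p \<in> K" "a \<bullet> p = 1" and strip: "\<And>x. x \<in> L \<Longrightarrow> \<bar>a \<bullet> x\<bar> \<le> 1"
  shows "K \<subseteq>opt L"
  unfolding optimally_contained_def
proof (intro conjI allI impI notI)
  fix \<rho> t
  assume \<rho>: "0 \<le> \<rho> \<and> \<rho> < 1" and "K \<subseteq> (\<lambda>x. t + \<rho> *\<^sub>R x) ` L"
  then obtain y z where "y \<in> L" "z \<in> L" and yz: "p = t + \<rho> *\<^sub>R y" "- p = t + \<rho> *\<^sub>R z"
    using assms(2,3) by blast
  then have "a \<bullet> y - a \<bullet> z \<le> 2"
    using strip[of y] strip[of z] by linarith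
  then have "\<rho> * (a \<bullet> y - a \<bullet> z) \<le> \<rho> * 2"
    using \<rho> by (intro mult_left_mono) auto
  \<comment> \<open>The translation \<open>t\<close> cancels in the difference.\<close>
  moreover have "a \<bullet> p - a \<bullet> (- p) = \<rho> * (a \<bullet> y - a \<bullet> z)"
    by (subst yz(2), subst yz(1)) (simp add: inner_right_distrib algebra_simps)
  ultimately show False
    using assms(4) \<rho> by simp
qed (fact assms(1))

theorem mainTheorem3:
  fixes s :: real
  assumes "s \<in> {1..(1 + sqrt 5) / 2}"
  shows "\<exists>C :: (real ^ 2) set. convex_body C \<and> minkowski_centered C \<and>
           minkowski_asymmetry C = s \<and>
           (C \<inter> uminus ` C) \<subseteq>opt (convex hull (C \<union> uminus ` C))"
proof (intro exI conjI)
  let ?C = "house s"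
  have s: "1 \<le> s"
    using assms by simp
  \<comment> \<open>Completing the square: \<open>(2 * s - 1)\<^sup>2 \<le> 5\<close> is the eaves
    condition multiplied by 4.\<close>
  have "(2 * s - 1)\<^sup>2 \<le> (sqrt 5)\<^sup>2"
    using assms by (intro power_mono) auto
  then have eaves: "0 \<le> 1 + s - s\<^sup>2"
    by (simp add: power2_eq_square algebra_simps)
  show "convex_body ?C"
    using convex_house compact_house aff_dim_house s by (simp add: convex_body_def)
  show asym: "minkowski_asymmetry ?C = s"
    using minkowski_asymmetry_house s eaves .
  show "minkowski_centered ?C"
    using house_subset_scaled_reflection s
    by (simp add: minkowski_centered_def minkowski_center_def asym)
  \<comment> \<open>At height 0 the roof condition at the walls reads
    \<open>s\<^sup>2 - 1 \<le> s\<close>.\<close>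
  have in_C: "axis 1 1 \<in> ?C" "- axis 1 1 \<in> ?C"
    using eaves by (auto simp: house_def axis_def)
  show "(?C \<inter> uminus ` ?C) \<subseteq>opt (convex hull (?C \<union> uminus ` ?C))"
  proof (rule optimally_contained_between_parallel_hyperplanes)
    show "?C \<inter> uminus ` ?C \<subseteq> convex hull (?C \<union> uminus ` ?C)"
      using hull_subset[of "?C \<union> uminus ` ?C" convex] by blast
    show "axis 1 1 \<in> ?C \<inter> uminus ` ?C" "- axis 1 1 \<in> ?C \<inter> uminus ` ?C"
      using in_C by (auto intro: image_eqI[where x = "- axis 1 1"])
    show "axis 1 1 \<bullet> (axis 1 1 :: real ^ 2) = 1"
      by (simp add: inner_axis_axis)
    fix x
    assume "x \<in> convex hull (?C \<union> uminus ` ?C)"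
    \<comment> \<open>The strip is convex and symmetric, so the wall bound on the house passes to
      its reflection and to the hull.\<close>
    moreover have "convex hull (?C \<union> uminus ` ?C) \<subseteq> {x. \<bar>axis 1 1 \<bullet> x\<bar> \<le> 1}"
      by (intro hull_minimal convex_halfspace_abs_le)
         (auto simp: house_def inner_axis')
    ultimately show "\<bar>axis 1 1 \<bullet> x\<bar> \<le> 1"
      by blast
  qed
qed

end
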